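(* Let $N\ge 3$, let $q$ be a prime power, and let $w\ge 1$ and $U_w\ge 0$ be integers. For a point $H$ of $\mathrm{PG}(N,q)$ let $n_w(H)$ be the number of caps in $\mathbf{S}(U_w)$ that do not cover $H$. Then the value $n_w(H)$ is the same for all points $H\in\mathrm{PG}(N,q)$.
   Context: $\mathrm{PG}(N,q)$ is the $N$-dimensional projective space over $\mathbb{F}_q$. A $w$-cap is a set of $w$ points no three of which are collinear. A point is covered by a cap $\mathcal{K}$ if it belongs to $\mathcal{K}$ or lies on a line meeting $\mathcal{K}$ in two points. $\mathbf{S}(U_w)$ denotes the set of all $w$-caps in $\mathrm{PG}(N,q)$ each of which does not cover exactly $U_w$ points of $\mathrm{PG}(N,q)$. *)

theory Defs
  imports "HOL-Analysis.Cartesian_Space" "HOL-Number_Theory.Prime_Powers"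
begin

text \<open>
  The space PG(N,q) is modelled on the coordinate space \<^typ>\<open>'a ^ 'n\<close>, where
  \<^typ>\<open>'a\<close> is a finite field with q elements and the index type \<^typ>\<open>'n\<close> has
  N + 1 elements: its points are the subspaces of vector space dimension 1. A line is
  represented by the set of points contained in a subspace of vector space dimension 2.
\<close>

definition pg_points :: "('a::field ^ 'n) set set" where
  "pg_points = {P. vec.subspace P \<and> vec.dim P = 1}"

definition pg_lines :: "('a::field ^ 'n) set set set" where
  "pg_lines = {{P \<in> pg_points. P \<subseteq> L} | L. vec.subspace L \<and> vec.dim L = 2}"

definition pg_collinear :: "('a::field ^ 'n) set \<Rightarrow> ('a ^ 'n) set \<Rightarrow> ('a ^ 'n) set \<Rightarrow> bool" where
  "pg_collinear P Q R \<longleftrightarrow> (\<exists>l \<in> pg_lines. P \<in> l \<and> Q \<in> l \<and> R \<in> l)"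

definition pg_cap :: "nat \<Rightarrow> ('a::{field,finite} ^ 'n) set set \<Rightarrow> bool" where
  "pg_cap w K \<longleftrightarrow> K \<subseteq> pg_points \<and> card K = w \<and>
     (\<forall>P\<in>K. \<forall>Q\<in>K. \<forall>R\<in>K. P \<noteq> Q \<and> P \<noteq> R \<and> Q \<noteq> R \<longrightarrow> \<not> pg_collinear P Q R)"

definition pg_covered :: "('a::{field,finite} ^ 'n) set set \<Rightarrow> ('a ^ 'n) set \<Rightarrow> bool" where
  "pg_covered K P \<longleftrightarrow> P \<in> K \<or> (\<exists>l \<in> pg_lines. card (l \<inter> K) = 2 \<and> P \<in> l)"

definition caps_uncovering :: "nat \<Rightarrow> nat \<Rightarrow> ('a::{field,finite} ^ 'n) set set set" where
  "caps_uncovering w U = {K. pg_cap w K \<and> card {P \<in> pg_points. \<not> pg_covered K P} = U}"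

definition num_caps_not_covering :: "nat \<Rightarrow> nat \<Rightarrow> ('a::{field,finite} ^ 'n) set \<Rightarrow> nat" where
  "num_caps_not_covering w U H = card {K \<in> caps_uncovering w U. \<not> pg_covered K H}"

end

theory Submission
  imports Defs
begin

text \<open>
  The general linear group acts transitively on the points of the projective space, and its
  elements preserve incidence, hence caps, coverage and the number of uncovered points. An
  element mapping \<open>H\<close> to \<open>H'\<close> therefore injects the caps counted for \<open>H\<close> into those
  counted for \<open>H'\<close>, and equality follows by exchanging the two points.
\<close>

text \<open>These are the elements of the general linear group. One such \<open>g\<close> acts on
  three levels: on vectors by \<open>g\<close>, on subspaces by \<open>image g\<close>, and on sets
  of points (lines, caps) by \<open>image (image g)\<close>.\<close>

definition linear_bij :: "('a::field ^ 'n \<Rightarrow> 'a ^ 'n) \<Rightarrow> bool" where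
  "linear_bij g \<longleftrightarrow> Vector_Spaces.linear (*s) (*s) g \<and> bij g"

lemma linear_bij_inv:
  assumes "linear_bij g"
  shows "linear_bij (inv g)"
proof -
  have lin: "Vector_Spaces.linear (*s) (*s) g" and "bij g"
    using assms by (auto simp: linear_bij_def)
  interpret g: Vector_Spaces.linear "(*s)" "(*s)" g by fact
  have inv: "g (inv g x) = x" "inv g (g x) = x" for x
    using \<open>bij g\<close> by (simp_all add: bij_is_inj bij_is_surj surj_f_inv_f)
  have "inv g (x + y) = inv g x + inv g y" for x y
    by (metis inv g.add)
  moreover have "inv g (c *s x) = c *s inv g x" for c x
    by (metis inv g.scale)
  ultimately have "Vector_Spaces.linear (*s) (*s) (inv g)"
    by (simp add: Vector_Spaces.linear_iff vec.vector_space_axioms)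
  then show ?thesis
    using \<open>bij g\<close> by (simp add: linear_bij_def bij_imp_bij_inv)
qed

text \<open>Undoing the action on subspaces and on sets of points is what later turns one-way
  preservation under every group element into an equivalence.\<close>

lemma linear_bij_inv_image:
  assumes "linear_bij g"
  shows "inv g ` g ` S = S" and "image (inv g) ` image g ` K = K"
proof -
  have "inj g"
    using assms by (simp add: linear_bij_def bij_is_inj)
  then show 1: "inv g ` g ` S = S" for S
    by (simp add: image_inv_f_f)
  show "image (inv g) ` image g ` K = K"
    by (simp only: image_image[of "image (inv g)"] 1 image_ident)
qed

lemma linear_bij_inj_image: "linear_bij g \<Longrightarrow> inj (image g)"
  by (metis injI linear_bij_inv_image(1))

lemma linear_bij_subspace:
  assumes "linear_bij g" and "vec.subspace S"
  shows "vec.subspace (g ` S)" and "vec.dim (g ` S) = vec.dim S"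
proof -
  have lin: "Vector_Spaces.linear (*s) (*s) g" and "inj g"
    using assms by (auto simp: linear_bij_def bij_is_inj)
  interpret g: Vector_Spaces.linear "(*s)" "(*s)" g by fact
  show "vec.subspace (g ` S)"
    using assms(2) by (rule g.subspace_image)
  show "vec.dim (g ` S) = vec.dim S"
    using \<open>inj g\<close> by (intro vec.dim_image_eq[OF lin]) (rule inj_on_subset, auto)
qed

lemma linear_bij_point: "linear_bij g \<Longrightarrow> P \<in> pg_points \<Longrightarrow> g ` P \<in> pg_points"
  by (simp add: pg_points_def linear_bij_subspace)

lemma linear_bij_line:
  assumes g: "linear_bij g" and "l \<in> pg_lines"
  shows "image g ` l \<in> pg_lines"
proof -
  obtain L where L: "vec.subspace L" "vec.dim L = 2" and l: "l = {P \<in> pg_points. P \<subseteq> L}"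
    using assms(2) by (auto simp: pg_lines_def)
  have "image g ` l = {P \<in> pg_points. P \<subseteq> g ` L}"
  proof (intro equalityI subsetI)
    fix P assume "P \<in> image g ` l"
    then show "P \<in> {P \<in> pg_points. P \<subseteq> g ` L}"
      using linear_bij_point[OF g] by (auto simp: l)
  next
    fix P assume P: "P \<in> {P \<in> pg_points. P \<subseteq> g ` L}"
    \<comment> \<open>Every point of the image subspace is hit: its preimage is its image under
      \<open>inv g\<close>, again a linear bijection, and hence a point, lying in
      \<open>L\<close>.\<close>
    have "inv g ` P \<in> pg_points"
      using P linear_bij_point[OF linear_bij_inv[OF g]] by auto
    moreover have "inv g ` P \<subseteq> L"
      using P linear_bij_inv_image(1)[OF g, of L] by blast
    moreover have "P = g ` inv g ` P"
      using g by (simp add: linear_bij_def bij_is_surj image_f_inv_f)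
    ultimately show "P \<in> image g ` l"
      unfolding l by blast
  qed
  then show ?thesis
    using linear_bij_subspace[OF g L(1)] L(2) by (auto simp: pg_lines_def)
qed

lemma linear_bij_collinear:
  assumes g: "linear_bij g"
  shows "pg_collinear (g ` P) (g ` Q) (g ` R) \<longleftrightarrow> pg_collinear P Q R"
proof -
  \<comment> \<open>Proved for an arbitrary \<open>f\<close> so that it serves for \<open>g\<close>
    and, in the converse direction, for \<open>inv g\<close>.\<close>
  have imp: "pg_collinear (f ` P) (f ` Q) (f ` R)"
    if "linear_bij f" "pg_collinear P Q R" for f :: "'a ^ 'b \<Rightarrow> 'a ^ 'b" and P Q R
    using that linear_bij_line[OF that(1)] unfolding pg_collinear_def by blast
  show ?thesis
    using imp[OF g, of P Q R] imp[OF linear_bij_inv[OF g], of "g ` P" "g ` Q" "g ` R"]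
    by (auto simp: linear_bij_inv_image(1)[OF g])
qed

lemma linear_bij_covered:
  fixes g :: "'a::{field,finite} ^ 'n \<Rightarrow> 'a ^ 'n"
  assumes g: "linear_bij g"
  shows "pg_covered (image g ` K) (g ` P) \<longleftrightarrow> pg_covered K P"
proof -
  have imp: "pg_covered (image f ` K) (f ` P)"
    if f: "linear_bij f" and cov: "pg_covered K P"
    for f :: "'a ^ 'n \<Rightarrow> 'a ^ 'n" and K P
    using cov unfolding pg_covered_def
  proof (elim disjE bexE conjE)
    fix l assume l: "l \<in> pg_lines" "card (l \<inter> K) = 2" "P \<in> l"
    \<comment> \<open>Injectivity makes images commute with intersections, so a line meeting
      \<open>K\<close> in two points goes to a line meeting the image of \<open>K\<close> in two
      points.\<close>
    have "image f ` l \<inter> image f ` K = image f ` (l \<inter> K)"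
      by (rule image_Int[OF linear_bij_inj_image[OF f], symmetric])
    then have "card (image f ` l \<inter> image f ` K) = card (l \<inter> K)"
      using card_image[OF inj_on_subset[OF linear_bij_inj_image[OF f] subset_UNIV]] by simp
    then show "f ` P \<in> image f ` K \<or>
        (\<exists>l\<in>pg_lines. card (l \<inter> image f ` K) = 2 \<and> f ` P \<in> l)"
      using l linear_bij_line[OF f] by (metis imageI)
  qed simp
  show ?thesis
    using imp[OF g, of K P] imp[OF linear_bij_inv[OF g], of "image g ` K" "g ` P"]
    by (auto simp only: linear_bij_inv_image[OF g])
qed

lemma linear_bij_points_image:
  assumes "linear_bij g"
  shows "image g ` pg_points = pg_points"
proof (intro equalityI subsetI)
  fix P :: "('a ^ 'b) set" assume "P \<in> pg_points"
  then have "inv g ` P \<in> pg_points"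
    using linear_bij_point[OF linear_bij_inv[OF assms]] by blast
  moreover have "P = g ` inv g ` P"
    using assms by (simp add: linear_bij_def bij_is_surj image_f_inv_f)
  ultimately show "P \<in> image g ` pg_points"
    by blast
qed (use linear_bij_point[OF assms] in blast)

lemma linear_bij_caps_uncovering:
  assumes g: "linear_bij g" and K: "K \<in> caps_uncovering w U"
  shows "image g ` K \<in> caps_uncovering w U"
proof -
  note inj = linear_bij_inj_image[OF g]
  have cap: "pg_cap w K" and U: "card {P \<in> pg_points. \<not> pg_covered K P} = U"
    using K by (auto simp: caps_uncovering_def)
  have "card (image g ` K) = card K"
    by (rule card_image) (rule inj_on_subset[OF inj subset_UNIV])
  then have "pg_cap w (image g ` K)"
    using cap linear_bij_point[OF g] unfolding pg_cap_def
    by (simp add: image_subset_iff subset_eq[of K] inj_eq[OF inj] linear_bij_collinear[OF g])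
  \<comment> \<open>Since \<open>g\<close> permutes the points, each point can be written as an
    image under \<open>g\<close>, and coverage is then compared before and after applying
    \<open>g\<close>.\<close>
  moreover have "{P \<in> pg_points. \<not> pg_covered (image g ` K) P} =
      image g ` {P \<in> pg_points. \<not> pg_covered K P}"
    by (subst linear_bij_points_image[OF g, symmetric]) (auto simp: linear_bij_covered[OF g])
  then have "card {P \<in> pg_points. \<not> pg_covered (image g ` K) P} = U"
    using card_image[OF inj_on_subset[OF inj subset_UNIV]] U by simp
  ultimately show ?thesis
    by (simp add: caps_uncovering_def)
qed

lemma linear_bij_num_caps_le:
  fixes g :: "'a::{field,finite} ^ 'n \<Rightarrow> 'a ^ 'n"
  assumes g: "linear_bij g"
  shows "num_caps_not_covering w U H \<le> num_caps_not_covering w U (g ` H)"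
  unfolding num_caps_not_covering_def
proof (rule card_inj_on_le)
  show "inj_on (image (image g)) {K \<in> caps_uncovering w U. \<not> pg_covered K H}"
    \<comment> \<open>The left inverse is \<open>image (image (inv g))\<close>.\<close>
    by (rule inj_on_inverseI) (rule linear_bij_inv_image(2)[OF g])
  show "image (image g) ` {K \<in> caps_uncovering w U. \<not> pg_covered K H} \<subseteq>
      {K \<in> caps_uncovering w U. \<not> pg_covered K (g ` H)}"
    using linear_bij_caps_uncovering[OF g] by (auto simp: linear_bij_covered[OF g])
qed simp

lemma pg_pointE:
  assumes "P \<in> pg_points"
  obtains u where "u \<noteq> 0" "P = vec.span {u}"
proof -
  obtain B where B: "vec.independent B" "vec.span B = P" "card B = 1"
    using assms by (auto simp: pg_points_def elim: vec.basis_subspace_exists)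
  then obtain u where "B = {u}"
    by (auto simp: card_1_singleton_iff)
  then show thesis
    using B that by auto
qed

text \<open>Each nonzero vector extends to a basis, and a bijection of the two bases matching
  \<open>u\<close> with \<open>v\<close> extends linearly to an invertible map.\<close>

lemma linear_bij_vector_transitive:
  fixes u v :: "'a::field ^ 'n"
  assumes "u \<noteq> 0" "v \<noteq> 0"
  obtains g where "linear_bij g" "g u = v"
proof -
  define B C where "B = vec.extend_basis {u}" and "C = vec.extend_basis {v}"
  have B: "u \<in> B" "vec.independent B" "vec.span B = UNIV"
    and C: "v \<in> C" "vec.independent C" "vec.span C = UNIV"
    using assms vec.extend_basis_superset[of "{u}"] vec.extend_basis_superset[of "{v}"]
    by (simp_all add: B_def C_def vec.independent_extend_basis)
  have fin: "finite B" "finite C"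
    using B C vec.finiteI_independent by blast+
  have "card B = card C"
    using vec.dim_eq_card B C by metis
  then have "card (B - {u}) = card (C - {v})"
    using B C by simp
  then obtain f where f: "bij_betw f (B - {u}) (C - {v})"
    using fin finite_same_card_bij by blast
  \<comment> \<open>The bijection \<open>f\<close> controls only the other basis vectors, so the
    value at \<open>u\<close> is set by hand.\<close>
  define f' where "f' = f(u := v)"
  have "f' ` (B - {u}) = C - {v}"
    using f by (auto simp: f'_def bij_betw_def)
  then have "f' ` B = C"
    using B(1) C(1) by (metis f'_def fun_upd_same image_insert insert_Diff)
  then obtain g where g: "Vector_Spaces.linear (*s) (*s) g" "\<forall>x\<in>B. g x = f' x" "range g = UNIV"
    using vec.linear_independent_extend_subspace[OF B(2), of f'] C(3) by auto
  moreover have "inj g"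
    using g vec.linear_surj_imp_inj by blast
  ultimately have "linear_bij g" "g u = v"
    using B(1) by (auto simp: linear_bij_def bij_def f'_def)
  then show thesis
    by (rule that)
qed

text \<open>A point is the span of a nonzero vector, and a linear map carries the span of
  \<open>u\<close> to the span of \<open>g u\<close>, so transitivity on nonzero vectors
  suffices.\<close>

lemma linear_bij_point_transitive:
  assumes "P \<in> pg_points" "Q \<in> pg_points"
  obtains g where "linear_bij g" "g ` P = Q"
proof -
  obtain u v where "u \<noteq> 0" "v \<noteq> 0" and PQ: "P = vec.span {u}" "Q = vec.span {v}"
    using assms by (metis pg_pointE)
  then obtain g where g: "linear_bij g" "g u = v"
    using linear_bij_vector_transitive by blast
  then have "g ` P = Q"
    using PQ vec.linear_span_image[of g "{u}"] by (simp add: linear_bij_def)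
  then show thesis
    using g that by blast
qed

theorem lemma3p1:
  fixes N q w U :: nat
    and H H' :: "('a::{field,finite} ^ 'n) set"
  assumes "N \<ge> 3" and "CARD('n) = N + 1"
    and "primepow q" and "CARD('a) = q"
    and "w \<ge> 1"
    and "H \<in> pg_points" and "H' \<in> pg_points"
  shows "num_caps_not_covering w U H = num_caps_not_covering w U H'"
proof (rule antisym)
  show "num_caps_not_covering w U H \<le> num_caps_not_covering w U H'"
    using linear_bij_num_caps_le linear_bij_point_transitive[OF assms(6,7)] by metis
  show "num_caps_not_covering w U H' \<le> num_caps_not_covering w U H"
    using linear_bij_num_caps_le linear_bij_point_transitive[OF assms(7,6)] by metis
qed

end
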